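(* Let $\mathcal{G}=(\mathcal{V},\mathcal{E})$ be a finite undirected graph without loops, with $\mathcal{V}=\mathcal{B}\cup\mathcal{I}$ partitioned into boundary nodes $\mathcal{B}$ and interior nodes $\mathcal{I}$. Let $\sigma\in(0,\infty)^{\mathcal{E}}$, $q\in\mathbb{R}^{\mathcal{I}}$, $N\ge1$, $f^{(j)}\in\mathbb{R}^{\mathcal{B}}$ for $j=1,\ldots,N$, and let $u^{(j)}\in\mathbb{R}^{\mathcal{V}}$ satisfy the Schrödinger Dirichlet problem $(L_\sigma u^{(j)})_{\mathcal{I}}+q\odot u^{(j)}_{\mathcal{I}}=0$, $u^{(j)}_{\mathcal{B}}=f^{(j)}$. Define $s^{(j)}:\mathcal{I}\to\{-1,1\}$ by $s^{(j)}=1-2\,\mathbb{1}_{\operatorname{supp}u^{(j)}_{\mathcal{I}}}$. Assume: (i) $\bigcup_{j=1}^N\operatorname{supp}u^{(j)}_{\mathcal{I}}=\mathcal{I}$; (ii) the matrix $[L_\sigma]_{\mathcal{I}\mathcal{I}}+\operatorname{diag}(q)$ is invertible; (iii) the matrices $[L_\sigma]_{\mathcal{I}\mathcal{I}}+\operatorname{diag}(s^{(j)}\odot q)$ are invertible for $j=1,\ldots,N$. Then the linearization at $(q,u^{(1)},\ldots,u^{(N)})$ of the problem of finding $q$ and the $u^{(j)}$ from the data $q\odot|u^{(j)}_{\mathcal{I}}|^2$, $j=1,\ldots,N$ (with $\sigma$ and $f^{(j)}$ known), is injective. That is, if $\delta q\in\mathbb{R}^{\mathcal{I}}$ and $\delta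 u^{(j)}\in\mathbb{R}^{\mathcal{V}}$, $j=1,\ldots,N$, satisfy for all $j=1,\ldots,N$ $$(L_\sigma\delta u^{(j)})_{\mathcal{I}}+\delta q\odot u^{(j)}_{\mathcal{I}}+q\odot\delta u^{(j)}_{\mathcal{I}}=0,$$ $$(\delta u^{(j)})_{\mathcal{B}}=0,$$ $$\delta q\odot|u^{(j)}_{\mathcal{I}}|^2+2q\odot\delta u^{(j)}_{\mathcal{I}}\odot u^{(j)}_{\mathcal{I}}=0,$$ then $\delta q=0$ and $\delta u^{(j)}=0$ for all $j=1,\ldots,N$.
   Context: For each edge $i\sim j$ an ordering of its endpoints is fixed once and for all. The discrete gradient $\nabla:\mathbb{R}^{\mathcal{V}}\to\mathbb{R}^{\mathcal{E}}$ is $(\nabla u)(i\sim j)=u(i)-u(j)$, and $\nabla^T$ is its transpose. $\odot$ is the componentwise product; absolute values and squares of vectors are componentwise. $L_\sigma u=\nabla^T(\sigma\odot\nabla u)$ is the discrete Laplacian, viewed as a symmetric $|\mathcal{V}|\times|\mathcal{V}|$ matrix; $[L_\sigma]_{\mathcal{I}\mathcal{I}}$ is the submatrix with rows and columns in $\mathcal{I}$. A subscript $\mathcal{I}$ or $\mathcal{B}$ on a vector denotes restriction. $\operatorname{supp}g=\{x:g(x)\ne0\}$ and $\mathbb{1}_X$ is the indicator function of $X$. *)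

theory Defs
  imports "HOL-Analysis.Analysis"
begin

text \<open>
  Vectors indexed by a finite set are functions whose values outside the index set are irrelevant;
  matrices are functions of a row and a column index. An edge is the two-element set of its
  endpoints, and \<open>src e\<close>, \<open>tgt e\<close> are its first and second endpoint in the fixed ordering.
\<close>

locale oriented_graph =
  fixes V :: "'v set" and E :: "'v set set" and src tgt :: "'v set \<Rightarrow> 'v"
  assumes finite_V: "finite V"
    and edge_subset: "e \<in> E \<Longrightarrow> e \<subseteq> V"
    and edge_card: "e \<in> E \<Longrightarrow> card e = 2"
    and edge_ends: "e \<in> E \<Longrightarrow> e = {src e, tgt e}"

definition grad :: "('e \<Rightarrow> 'v) \<Rightarrow> ('e \<Rightarrow> 'v) \<Rightarrow> ('v \<Rightarrow> real) \<Rightarrow> 'e \<Rightarrow> real" where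
  "grad src tgt u e = u (src e) - u (tgt e)"

text \<open>
  The matrix of the gradient has the entry \<open>grad src tgt (indicator {i}) e\<close> in row \<open>e\<close> and
  column \<open>i\<close>; \<open>gradT\<close> multiplies by the transpose of this matrix.
\<close>

definition gradT :: "'e set \<Rightarrow> ('e \<Rightarrow> 'v) \<Rightarrow> ('e \<Rightarrow> 'v) \<Rightarrow> ('e \<Rightarrow> real) \<Rightarrow> 'v \<Rightarrow> real" where
  "gradT E src tgt w i = (\<Sum>e\<in>E. grad src tgt (indicator {i}) e * w e)"

definition laplacian ::
  "'e set \<Rightarrow> ('e \<Rightarrow> 'v) \<Rightarrow> ('e \<Rightarrow> 'v) \<Rightarrow> ('e \<Rightarrow> real) \<Rightarrow> ('v \<Rightarrow> real) \<Rightarrow> 'v \<Rightarrow> real" where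
  "laplacian E src tgt \<sigma> u = gradT E src tgt (\<lambda>e. \<sigma> e * grad src tgt u e)"

definition laplacian_matrix ::
  "'e set \<Rightarrow> ('e \<Rightarrow> 'v) \<Rightarrow> ('e \<Rightarrow> 'v) \<Rightarrow> ('e \<Rightarrow> real) \<Rightarrow> 'v \<Rightarrow> 'v \<Rightarrow> real" where
  "laplacian_matrix E src tgt \<sigma> i j = laplacian E src tgt \<sigma> (indicator {j}) i"

definition diag :: "('v \<Rightarrow> real) \<Rightarrow> 'v \<Rightarrow> 'v \<Rightarrow> real" where
  "diag d i j = (if i = j then d i else 0)"

text \<open>Invertibility of the (sub)matrix of \<open>A\<close> with rows and columns in \<open>X\<close>.\<close>

definition invertible_on :: "'v set \<Rightarrow> ('v \<Rightarrow> 'v \<Rightarrow> real) \<Rightarrow> bool" where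
  "invertible_on X A \<longleftrightarrow> (\<exists>A'. \<forall>i\<in>X. \<forall>j\<in>X.
     (\<Sum>k\<in>X. A i k * A' k j) = (if i = j then 1 else 0) \<and>
     (\<Sum>k\<in>X. A' i k * A k j) = (if i = j then 1 else 0))"

definition supp_on :: "'v set \<Rightarrow> ('v \<Rightarrow> real) \<Rightarrow> 'v set" where
  "supp_on X u = {i \<in> X. u i \<noteq> 0}"

definition sgn_supp :: "'v set \<Rightarrow> ('v \<Rightarrow> real) \<Rightarrow> 'v \<Rightarrow> real" where
  "sgn_supp X u i = 1 - 2 * indicator (supp_on X u) i"


lemma invertible_on_UNIV:
  fixes A :: "real ^ 'n ^ 'n"
  shows "invertible_on UNIV (\<lambda>i j. A $ i $ j) \<longleftrightarrow> invertible A"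
proof
  assume "invertible_on UNIV (\<lambda>i j. A $ i $ j)"
  then obtain A' where *: "\<And>i j. (\<Sum>k\<in>UNIV. A $ i $ k * A' k j) = (if i = j then 1 else 0)"
      "\<And>i j. (\<Sum>k\<in>UNIV. A' i k * A $ k $ j) = (if i = j then 1 else 0)"
    unfolding invertible_on_def by blast
  have "A ** (\<chi> i j. A' i j) = mat 1" "(\<chi> i j. A' i j) ** A = mat 1"
    using * by (auto simp: matrix_matrix_mult_def mat_def vec_eq_iff)
  then show "invertible A" unfolding invertible_def by blast
next
  assume "invertible A"
  then obtain A' where *: "A ** A' = mat 1" "A' ** A = mat 1"
    unfolding invertible_def by blast
  then show "invertible_on UNIV (\<lambda>i j. A $ i $ j)"
    unfolding invertible_on_def
    by (intro exI[of _ "\<lambda>i j. A' $ i $ j"]) (auto simp: matrix_matrix_mult_def mat_def vec_eq_iff)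
qed

context oriented_graph
begin

lemma finite_E: "finite E"
  using finite_subset[of E "Pow V"] finite_V edge_subset by auto

lemma src_in: "e \<in> E \<Longrightarrow> src e \<in> V" and tgt_in: "e \<in> E \<Longrightarrow> tgt e \<in> V"
  using edge_subset[of e] edge_ends[of e] by blast+

lemma src_neq_tgt: "e \<in> E \<Longrightarrow> src e \<noteq> tgt e"
proof
  assume "e \<in> E" "src e = tgt e"
  then have "e = {src e}" "card e = 2"
    using edge_card[of e] edge_ends[of e] by auto
  then show False by (metis card_1_singleton_iff One_nat_def n_not_Suc_n numeral_2_eq_2)
qed

lemma grad_expand:
  assumes "e \<in> E"
  shows "grad src tgt u e = (\<Sum>i\<in>V. grad src tgt (indicator {i}) e * u i)"
proof -
  have *: "(\<Sum>i\<in>V. indicator {i} x * u i) = u x" if "x \<in> V" for x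
  proof -
    have "(\<Sum>i\<in>V. indicator {i} x * u i) = (\<Sum>i\<in>V. if x = i then u i else 0)"
      by (rule sum.cong) (auto simp: indicator_def)
    then show ?thesis using that finite_V by simp
  qed
  show ?thesis
    unfolding grad_def
    using *[OF src_in[OF assms]] *[OF tgt_in[OF assms]]
    by (simp add: left_diff_distrib sum_subtractf)
qed

lemma gradT_adjoint:
  "(\<Sum>e\<in>E. w e * grad src tgt u e) = (\<Sum>i\<in>V. gradT E src tgt w i * u i)"
proof -
  have "(\<Sum>e\<in>E. w e * grad src tgt u e)
      = (\<Sum>e\<in>E. \<Sum>i\<in>V. w e * (grad src tgt (indicator {i}) e * u i))"
    using grad_expand[of _ u] by (intro sum.cong refl) (simp add: sum_distrib_left)
  also have "\<dots> = (\<Sum>i\<in>V. \<Sum>e\<in>E. w e * (grad src tgt (indicator {i}) e * u i))"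
    by (rule sum.swap)
  also have "\<dots> = (\<Sum>i\<in>V. gradT E src tgt w i * u i)"
    by (simp add: gradT_def sum_distrib_left mult_ac)
  finally show ?thesis .
qed

lemma laplacian_eq_matrix:
  "laplacian E src tgt \<sigma> u i = (\<Sum>j\<in>V. laplacian_matrix E src tgt \<sigma> i j * u j)"
proof -
  have "laplacian E src tgt \<sigma> u i
      = (\<Sum>e\<in>E. \<Sum>j\<in>V. grad src tgt (indicator {i}) e * \<sigma> e * (grad src tgt (indicator {j}) e * u j))"
    unfolding laplacian_def gradT_def
    using grad_expand[of _ u] by (intro sum.cong refl) (simp add: sum_distrib_left mult_ac)
  also have "\<dots> = (\<Sum>j\<in>V. \<Sum>e\<in>E. grad src tgt (indicator {i}) e * \<sigma> e * (grad src tgt (indicator {j}) e * u j))"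
    by (rule sum.swap)
  also have "\<dots> = (\<Sum>j\<in>V. laplacian_matrix E src tgt \<sigma> i j * u j)"
    by (simp add: laplacian_matrix_def laplacian_def gradT_def sum_distrib_left mult_ac)
  finally show ?thesis .
qed

lemma laplacian_matrix_sym:
  "laplacian_matrix E src tgt \<sigma> i j = laplacian_matrix E src tgt \<sigma> j i"
  by (simp add: laplacian_matrix_def laplacian_def gradT_def mult_ac)

end

lemma laplacian_linear:
  "laplacian E src tgt \<sigma> (\<lambda>i. u i + t * v i) i
     = laplacian E src tgt \<sigma> u i + t * laplacian E src tgt \<sigma> v i"
  by (simp add: laplacian_def gradT_def grad_def sum_distrib_left algebra_simps flip: sum.distrib)

text \<open>
  The linearized interior equation and the linearized data are the directional derivatives of
  the nonlinear ones.
\<close>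

lemma linearized_equation:
  "((\<lambda>t. laplacian E src tgt \<sigma> (\<lambda>i. u i + t * du i) i + (q i + t * dq i) * (u i + t * du i))
     has_real_derivative
      laplacian E src tgt \<sigma> du i + dq i * u i + q i * du i) (at 0)"
  unfolding laplacian_linear
  by (auto intro!: derivative_eq_intros simp: algebra_simps)

lemma linearized_data:
  fixes q dq u du :: "'v \<Rightarrow> real"
  shows "((\<lambda>t. (q i + t * dq i) * \<bar>u i + t * du i\<bar>\<^sup>2)
     has_real_derivative dq i * \<bar>u i\<bar>\<^sup>2 + 2 * q i * du i * u i) (at 0)"
  unfolding power2_abs
  by (auto intro!: derivative_eq_intros simp: algebra_simps power2_eq_square)

end

theory Submission
  imports Defs
begin

text \<open>
  Where \<open>u j\<close> does not vanish, the linearized data determine \<open>\<delta>q\<close> through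
  \<open>\<delta>q * u j = - 2 * q * \<delta>u j\<close>; where it vanishes, the term \<open>\<delta>q * u j\<close> is absent anyway.
  Eliminating \<open>\<delta>q\<close> from the linearized equation thus leaves a Schroedinger equation for \<open>\<delta>u j\<close>
  alone, with potential \<open>- q\<close> on the support of \<open>u j\<close> and \<open>q\<close> off it, which is
  \<open>sgn_supp I (u j) * q\<close>. With zero boundary values this is a linear system with one of the
  matrices assumed invertible, so \<open>\<delta>u j = 0\<close>. Then \<open>\<delta>q * u j = 0\<close> for every \<open>j\<close>, and
  \<open>\<delta>q = 0\<close> because the supports cover \<open>I\<close>.
\<close>

lemma invertible_on_kernel_trivial:
  assumes "invertible_on X A" and "finite X"
    and ker: "\<And>i. i \<in> X \<Longrightarrow> (\<Sum>k\<in>X. A i k * v k) = 0"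
    and "i \<in> X"
  shows "v i = 0"
proof -
  obtain A' where A': "\<And>i j. i \<in> X \<Longrightarrow> j \<in> X \<Longrightarrow>
      (\<Sum>k\<in>X. A' i k * A k j) = (if i = j then 1 else 0)"
    using assms(1) unfolding invertible_on_def by blast
  have "v i = (\<Sum>j\<in>X. (if i = j then 1 else 0) * v j)"
    using \<open>finite X\<close> \<open>i \<in> X\<close> by (simp add: if_distrib if_distribR cong: if_cong)
  also have "\<dots> = (\<Sum>j\<in>X. \<Sum>k\<in>X. A' i k * (A k j * v j))"
    using A'[OF \<open>i \<in> X\<close>] by (intro sum.cong refl) (simp flip: sum_distrib_right mult.assoc)
  also have "\<dots> = (\<Sum>k\<in>X. A' i k * (\<Sum>j\<in>X. A k j * v j))"
    unfolding sum_distrib_left by (rule sum.swap)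
  also have "\<dots> = 0"
    using ker by simp
  finally show ?thesis .
qed

text \<open>
  Zero values outside the interior let the full Laplacian be computed from its interior block, so
  that invertibility of the block amounts to uniqueness for the Dirichlet problem.
\<close>

lemma (in oriented_graph) schroedinger_dirichlet_unique:
  assumes "V = B \<union> I"
    and inv: "invertible_on I (\<lambda>i k. laplacian_matrix E src tgt \<sigma> i k + diag p i k)"
    and eq: "\<And>i. i \<in> I \<Longrightarrow> laplacian E src tgt \<sigma> v i + p i * v i = 0"
    and bdry: "\<And>i. i \<in> B \<Longrightarrow> v i = 0"
    and "i \<in> V"
  shows "v i = 0"
proof -
  have fin: "finite I"
    using finite_V \<open>V = B \<union> I\<close> by simp
  have "(\<Sum>k\<in>I. (laplacian_matrix E src tgt \<sigma> l k + diag p l k) * v k) = 0" if "l \<in> I" for l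
  proof -
    have "laplacian E src tgt \<sigma> v l = (\<Sum>k\<in>I. laplacian_matrix E src tgt \<sigma> l k * v k)"
      unfolding laplacian_eq_matrix
      by (rule sum.mono_neutral_right) (use assms(1) finite_V bdry in auto)
    moreover have "(\<Sum>k\<in>I. diag p l k * v k) = p l * v l"
      using fin that by (simp add: diag_def if_distrib if_distribR cong: if_cong)
    ultimately show ?thesis
      using eq[OF that] by (simp add: distrib_right sum.distrib)
  qed
  then have "v l = 0" if "l \<in> I" for l
    using invertible_on_kernel_trivial[OF inv fin] that by blast
  then show ?thesis
    using bdry assms(1) \<open>i \<in> V\<close> by blast
qed

theorem theorem4:
  fixes V B I :: "'v set" and E :: "'v set set" and src tgt :: "'v set \<Rightarrow> 'v"
    and \<sigma> :: "'v set \<Rightarrow> real" and q \<delta>q :: "'v \<Rightarrow> real"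
    and N :: nat and f u \<delta>u :: "nat \<Rightarrow> 'v \<Rightarrow> real"
  assumes "oriented_graph V E src tgt"
    and "V = B \<union> I" and "B \<inter> I = {}"
    and "\<forall>e\<in>E. \<sigma> e > 0"
    and "N \<ge> 1"
    and "\<forall>j\<in>{1..N}. \<forall>i\<in>I. laplacian E src tgt \<sigma> (u j) i + q i * u j i = 0"
    and "\<forall>j\<in>{1..N}. \<forall>i\<in>B. u j i = f j i"
    and "(\<Union>j\<in>{1..N}. supp_on I (u j)) = I"
    and "invertible_on I (\<lambda>i k. laplacian_matrix E src tgt \<sigma> i k + diag q i k)"
    and "\<forall>j\<in>{1..N}. invertible_on I
           (\<lambda>i k. laplacian_matrix E src tgt \<sigma> i k + diag (\<lambda>x. sgn_supp I (u j) x * q x) i k)"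
    and "\<forall>j\<in>{1..N}. \<forall>i\<in>I.
           laplacian E src tgt \<sigma> (\<delta>u j) i + \<delta>q i * u j i + q i * \<delta>u j i = 0"
    and "\<forall>j\<in>{1..N}. \<forall>i\<in>B. \<delta>u j i = 0"
    and "\<forall>j\<in>{1..N}. \<forall>i\<in>I. \<delta>q i * \<bar>u j i\<bar>\<^sup>2 + 2 * q i * \<delta>u j i * u j i = 0"
  shows "(\<forall>i\<in>I. \<delta>q i = 0) \<and> (\<forall>j\<in>{1..N}. \<forall>i\<in>V. \<delta>u j i = 0)"
proof -
  interpret oriented_graph V E src tgt by fact
  have \<delta>u_zero: "\<delta>u j i = 0" if j: "j \<in> {1..N}" and "i \<in> V" for j i
  proof (rule schroedinger_dirichlet_unique[OF assms(2)])
    show "invertible_on I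
        (\<lambda>i k. laplacian_matrix E src tgt \<sigma> i k + diag (\<lambda>x. sgn_supp I (u j) x * q x) i k)"
      using assms(10) j by blast
    show "laplacian E src tgt \<sigma> (\<delta>u j) x + sgn_supp I (u j) x * q x * \<delta>u j x = 0"
      if x: "x \<in> I" for x
    proof (cases "u j x = 0")
      case True
      then have "sgn_supp I (u j) x = 1"
        by (simp add: sgn_supp_def supp_on_def)
      then show ?thesis
        using assms(11) j x True by force
    next
      case False
      then have s: "sgn_supp I (u j) x = - 1"
        using x by (simp add: sgn_supp_def supp_on_def)
      have "(\<delta>q x * u j x + 2 * q x * \<delta>u j x) * u j x = 0"
        using assms(13) j x by (simp add: power2_eq_square algebra_simps)
      then have "\<delta>q x * u j x = - 2 * q x * \<delta>u j x"
        using False by simp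
      moreover have "laplacian E src tgt \<sigma> (\<delta>u j) x + \<delta>q x * u j x + q x * \<delta>u j x = 0"
        using assms(11) j x by blast
      ultimately show ?thesis
        by (simp add: s)
    qed
    show "\<delta>u j x = 0" if "x \<in> B" for x
      using assms(12) j that by blast
  qed fact
  have "\<delta>q i = 0" if i: "i \<in> I" for i
  proof -
    obtain j where j: "j \<in> {1..N}" and "u j i \<noteq> 0"
      using assms(8) i unfolding supp_on_def by blast
    moreover have "\<delta>u j i = 0"
      using \<delta>u_zero j i assms(2) by blast
    ultimately show ?thesis
      using assms(13) i by force
  qed
  with \<delta>u_zero show ?thesis
    by blast
qed

end
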